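(* Let $s\ge3$ be an integer and assume the following conjecture: for every integer $s'\ge3$ there exists $\vartheta=\vartheta(s')>0$ such that $R(s'-1,t)\,t^{\vartheta}\le R(s',t)$ for all sufficiently large $t$. Then, as $n\to\infty$: (1) if $t\ge R^{-1}\!\left(\frac{s+1}{2},n\right)\log n$, then $g(n;s,t)=\Theta(n^2)$; (2) if $t\le R^{-1}\!\left(\frac{s+3}{2},n\right)$, then $g(n;s,t)=o(n^2)$.
   Context: $R(s,t)$ denotes the Ramsey number. $R^{-1}(\ell,n)$ (the inverse Ramsey number) is the minimum independence number of an $n$-vertex graph with no clique of size $\ell$ (i.e. with clique number less than $\ell$). A red/blue/purple colouring of $K_n$ is a partition $R\cup B\cup P$ of its edge set. For integers $s,t\ge2$ and $n<R(s,t)$, $g(n;s,t)$ is the largest integer $g$ such that some red/blue/purple colouring of $K_n$ has $|P|=g$, $R\cup P$ is $K_s$-free and $B\cup P$ is $K_t$-free; for non-integer arguments $g(n;s,t):=g(n;\lceil s\rceil,\lceil t\rceil)$. Logarithms are base 2.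
   Formalization: For even s the half-integers (s+1)/2 and (s+3)/2 in R^{-1} are rounded down; reading R^{-1} there as "clique number less than ℓ" (rounding up) makes (1) false, e.g. for s=4 and t=R^{-1}(3,n) log n. In (2) the limit is over those n with n<R(s,t), where g is defined. *)

theory Defs
  imports Complex_Main "HOL-Library.Ramsey" "HOL-Library.Landau_Symbols"
begin

text \<open>
  The vertex set of an \<open>n\<close>-vertex graph is \<^term>\<open>{..<n::nat}\<close>; its edge set is a set of 2-element
  subsets of \<^term>\<open>{..<n::nat}\<close>.
\<close>

definition ramsey_number :: "nat \<Rightarrow> nat \<Rightarrow> nat" where
  "ramsey_number s t = (LEAST n. partn_lst {..<n} [s, t] 2)"

definition clique_free :: "nat \<Rightarrow> nat \<Rightarrow> nat set set \<Rightarrow> bool" where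
  "clique_free k n E \<longleftrightarrow> \<not> (\<exists>K \<subseteq> {..<n}. card K = k \<and> clique K E)"

definition independence_number :: "nat \<Rightarrow> nat set set \<Rightarrow> nat" where
  "independence_number n E = Max {card I | I. I \<subseteq> {..<n} \<and> indep I E}"

definition inverse_ramsey :: "nat \<Rightarrow> nat \<Rightarrow> nat" where
  "inverse_ramsey l n =
     Min {independence_number n E | E. E \<subseteq> [{..<n}]\<^bsup>2\<^esup> \<and> clique_free l n E}"

text \<open>
  For even \<open>s\<close> the first argument of the inverse Ramsey number is the half-integer \<open>(s+1)/2\<close> or
  \<open>(s+3)/2\<close>. It is rounded down, the rounding that fits both thresholds. Joining completely
  by purple edges two red graphs without a clique of size \<open>l\<close> gives red-purple cliques of size at
  most \<open>2(l-1)\<close>, and this is below \<open>s\<close> iff \<open>l \<le> (s+1)/2\<close>. Rounding up would make the lower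
  threshold wrong: for \<open>s = 4\<close> it would assert a dense \<open>K\<^sub>4\<close>-free graph with independence number
  at most \<open>n\<close> to the power \<open>1/2 + o(1)\<close>, which dependent random choice rules out. In the upper
  threshold rounding down is the stronger choice, since the inverse Ramsey number is antitone in
  \<open>l\<close>.
\<close>

definition inverse_ramsey_real :: "real \<Rightarrow> nat \<Rightarrow> nat" where
  "inverse_ramsey_real l n = inverse_ramsey (nat \<lfloor>l\<rfloor>) n"

definition rbp_colouring :: "nat \<Rightarrow> nat set set \<Rightarrow> nat set set \<Rightarrow> nat set set \<Rightarrow> bool" where
  "rbp_colouring n R B P \<longleftrightarrow>
     R \<union> B \<union> P = [{..<n}]\<^bsup>2\<^esup> \<and> R \<inter> B = {} \<and> R \<inter> P = {} \<and> B \<inter> P = {}"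

text \<open>Only meaningful for \<open>s, t \<ge> 2\<close> and \<open>n\<close> below the Ramsey number; otherwise \<^const>\<open>Max\<close> is
  taken over the empty set.\<close>

definition max_purple :: "nat \<Rightarrow> nat \<Rightarrow> nat \<Rightarrow> nat" where
  "max_purple n s t =
     Max {card P | R B P. rbp_colouring n R B P \<and>
            clique_free s n (R \<union> P) \<and> clique_free t n (B \<union> P)}"

definition max_purple_real :: "nat \<Rightarrow> real \<Rightarrow> real \<Rightarrow> nat" where
  "max_purple_real n s t = max_purple n (nat \<lceil>s\<rceil>) (nat \<lceil>t\<rceil>)"

definition max_purple_dom :: "nat \<Rightarrow> (nat \<Rightarrow> real) \<Rightarrow> nat set" where
  "max_purple_dom s t = {n. 2 \<le> s \<and> 2 \<le> \<lceil>t n\<rceil> \<and> n < ramsey_number s (nat \<lceil>t n\<rceil>)}"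

definition ramsey_gap_conjecture :: bool where
  "ramsey_gap_conjecture \<longleftrightarrow>
     (\<forall>s'\<ge>3. \<exists>\<theta>>0. \<forall>\<^sub>F t in sequentially.
        real (ramsey_number (s' - 1) t) * real t powr \<theta> \<le> real (ramsey_number s' t))"

end

theory Submission
  imports Defs
begin

text \<open>
  Part (1): let \<open>l = \<lfloor>(s+1)/2\<rfloor>\<close>, split the vertices into two halves, put an extremal
  \<open>K\<^sub>l\<close>-free red graph inside each half, and colour all edges between the halves purple. The
  blue-purple cliques have at most twice the inverse Ramsey number of vertices, so any factor above
  2 in place of \<open>log n\<close> would do.

  Part (2): let \<open>m = \<lceil>s/2\<rceil>\<close>. The bound on \<open>t\<close> says \<open>R(m+1,t) \<le> n\<close>; since \<open>t\<close> is at least a power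
  of \<open>n\<close>, the conjecture makes \<open>R(m,t)\<close> smaller than \<open>n\<close> by a power of \<open>n\<close>, and every set of
  \<open>R(m,t)\<close> vertices contains a red \<open>K\<^sub>m\<close>. If the purple graph were dense, dependent random choice
  would give a red \<open>K\<^sub>m\<close> whose common purple neighbourhood has more than \<open>R(m,t)\<close> vertices and so
  contains another red \<open>K\<^sub>m\<close>; together they form a red-purple \<open>K\<^sub>2\<^sub>m\<close>.
\<close>

section \<open>Ramsey numbers\<close>

lemma partn_lst_ramsey_number: "partn_lst {..<ramsey_number s t} [s, t] 2"
  unfolding ramsey_number_def using ramsey2_full by (rule LeastI)

lemma ramsey_number_le_power: "ramsey_number s t \<le> (s + t) ^ s"
proof -
  have "ramsey_number s t \<le> ES 2 s t"
    unfolding ramsey_number_def using ramsey2_full by (rule Least_le)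
  also have "\<dots> = (s + t) choose s"
    by (rule ES2_choose)
  also have "\<dots> \<le> (s + t) ^ s"
    by (rule binomial_le_pow) simp
  finally show ?thesis .
qed

lemma ramsey_number_leI:
  assumes "\<And>E. E \<subseteq> [{..<n}]\<^bsup>2\<^esup> \<Longrightarrow>
    \<exists>K \<subseteq> {..<n}. card K = s \<and> clique K E \<or> card K = t \<and> indep K E"
  shows "ramsey_number s t \<le> n"
  unfolding ramsey_number_def
proof (rule Least_le, unfold partn_lst_def, intro ballI)
  fix f :: "nat set \<Rightarrow> nat"
  assume f: "f \<in> [{..<n}]\<^bsup>2\<^esup> \<rightarrow> {..<length [s, t]}"
  define E where "E = {e \<in> [{..<n}]\<^bsup>2\<^esup>. f e = 0}"
  obtain K where K: "K \<subseteq> {..<n}" "card K = s \<and> clique K E \<or> card K = t \<and> indep K E"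
    using assms[of E] by (auto simp: E_def)
  have finK: "finite K"
    using K(1) finite_subset by blast
  have f2: "f e = 0 \<or> f e = 1" if "e \<in> [{..<n}]\<^bsup>2\<^esup>" for e
    using f that by (fastforce simp: Pi_def)
  have *: "e \<in> [{..<n}]\<^bsup>2\<^esup>" if "e \<in> [K]\<^bsup>2\<^esup>" for e
    using that nsets_mono[OF K(1)] by blast
  from K(2) show "\<exists>i<length [s, t]. monochromatic {..<n} ([s, t] ! i) 2 f i"
  proof
    assume "card K = s \<and> clique K E"
    then have "K \<in> [{..<n}]\<^bsup>s\<^esup>" "f ` [K]\<^bsup>2\<^esup> \<subseteq> {0}"
      using K(1) finK by (auto simp: nsets_def[of _ s] clique_def E_def elim!: nsets2_E)
    then show ?thesis
      unfolding monochromatic_def by (intro exI[of _ 0]) auto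
  next
    assume "card K = t \<and> indep K E"
    then have K': "K \<in> [{..<n}]\<^bsup>t\<^esup>" and indep: "indep K E"
      using K(1) finK by (auto simp: nsets_def)
    have "f ` [K]\<^bsup>2\<^esup> \<subseteq> {1}"
    proof clarify
      fix e assume e: "e \<in> [K]\<^bsup>2\<^esup>"
      then have "e \<notin> E"
        using indep by (auto simp: indep_def elim!: nsets2_E)
      then show "f e = 1"
        using f2[OF *[OF e]] *[OF e] by (auto simp: E_def)
    qed
    with K' show ?thesis
      unfolding monochromatic_def by (intro exI[of _ 1]) auto
  qed
qed

lemma ramsey_number_clique_or_indep:
  fixes V :: "'a set"
  assumes "finite V" "ramsey_number s t \<le> card V"
  obtains K where "K \<subseteq> V" "card K = s \<and> clique K E \<or> card K = t \<and> indep K E"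
proof -
  obtain h where h: "bij_betw h {..<card V} V"
    using ex_bij_betw_nat_finite[OF assms(1)] by (auto simp: atLeast0LessThan)
  define f where "f e = (if h ` e \<in> E then 0 else 1 :: nat)" for e
  have "partn_lst {..<card V} [s, t] 2"
    using partn_lst_ramsey_number assms(2) by (rule partn_lst_greater_resource)
  moreover have "f \<in> [{..<card V}]\<^bsup>2\<^esup> \<rightarrow> {..<length [s, t]}"
    by (auto simp: f_def)
  ultimately obtain i H where i: "i < length [s, t]" and H: "H \<in> nsets {..<card V} ([s, t] ! i)"
    and mono: "f ` [H]\<^bsup>2\<^esup> \<subseteq> {i}"
    unfolding partn_lst_def monochromatic_def by blast
  have HV: "H \<subseteq> {..<card V}" and cardH: "card H = [s, t] ! i"
    using H by (auto simp: nsets_def)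
  have inj: "inj_on h H"
    using h HV by (auto simp: bij_betw_def intro: inj_on_subset)
  have edge: "{h x, h y} \<in> E \<longleftrightarrow> i = 0" if "x \<in> H" "y \<in> H" "x \<noteq> y" for x y
  proof -
    have "{x, y} \<in> [H]\<^bsup>2\<^esup>"
      using that by simp
    then have "f {x, y} = i"
      using mono by blast
    then show ?thesis
      by (auto simp: f_def split: if_splits)
  qed
  have "card (h ` H) = [s, t] ! i" "h ` H \<subseteq> V"
    using card_image[OF inj] cardH h HV by (auto simp: bij_betw_def)
  moreover have "clique (h ` H) E" if "i = 0"
    using edge that unfolding clique_def by blast
  moreover have "indep (h ` H) E" if "i = 1"
    using edge that unfolding indep_def by auto
  ultimately show thesis
    using that[of "h ` H"] i by (auto simp: less_Suc_eq)
qed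

lemma lt_ramsey_numberE:
  assumes "n < ramsey_number s t"
  obtains E where "E \<subseteq> [{..<n}]\<^bsup>2\<^esup>" "clique_free s n E" "clique_free t n ([{..<n}]\<^bsup>2\<^esup> - E)"
proof -
  obtain E where E: "E \<subseteq> [{..<n}]\<^bsup>2\<^esup>"
    and no: "\<not> (\<exists>K \<subseteq> {..<n}. card K = s \<and> clique K E \<or> card K = t \<and> indep K E)"
    using assms ramsey_number_leI[of n s t] by (meson not_le)
  show thesis
  proof (rule that[OF E])
    show "clique_free s n E"
      using no unfolding clique_free_def by blast
    show "clique_free t n ([{..<n}]\<^bsup>2\<^esup> - E)"
      using no unfolding clique_free_def clique_def indep_def by blast
  qed
qed

lemma finite_indep_cards: "finite {card I | I. I \<subseteq> {..<n::nat} \<and> indep I E}"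
  by (rule finite_surj[of "Pow {..<n}" _ card]) auto

lemma card_le_independence_number:
  assumes "I \<subseteq> {..<n}" "indep I E"
  shows "card I \<le> independence_number n E"
  unfolding independence_number_def
  using finite_indep_cards by (rule Max_ge) (use assms in blast)

lemma independence_number_witness:
  obtains I where "I \<subseteq> {..<n}" "indep I E" "card I = independence_number n E"
proof -
  have "independence_number n E \<in> {card I | I. I \<subseteq> {..<n} \<and> indep I E}"
    unfolding independence_number_def using finite_indep_cards
    by (rule Max_in) (use null_indep in blast)
  then show thesis
    using that by auto
qed

lemma finite_independence_numbers:
  "finite {independence_number n E | E. E \<subseteq> [{..<n}]\<^bsup>2\<^esup> \<and> clique_free l n E}"
  by (rule finite_surj[of "Pow ([{..<n}]\<^bsup>2\<^esup>)" _ "independence_number n"])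
     (auto simp: finite_imp_finite_nsets)

lemma inverse_ramsey_le:
  assumes "E \<subseteq> [{..<n}]\<^bsup>2\<^esup>" "clique_free l n E"
  shows "inverse_ramsey l n \<le> independence_number n E"
  unfolding inverse_ramsey_def
  using finite_independence_numbers by (rule Min_le) (use assms in blast)

lemma inverse_ramsey_witness:
  assumes "2 \<le> l"
  obtains E where "E \<subseteq> [{..<n}]\<^bsup>2\<^esup>" "clique_free l n E" "independence_number n E = inverse_ramsey l n"
proof -
  have "clique_free l n {}"
    unfolding clique_free_def
  proof clarify
    fix K :: "nat set" assume "l = card K" "clique K {}"
    moreover from this assms obtain x y where "x \<in> K" "y \<in> K" "x \<noteq> y"
      by (meson card_2_iff' obtain_subset_with_card_n subsetD)
    ultimately show False
      by (auto simp: clique_def)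
  qed
  then have "inverse_ramsey l n \<in> {independence_number n E | E. E \<subseteq> [{..<n}]\<^bsup>2\<^esup> \<and> clique_free l n E}"
    unfolding inverse_ramsey_def
    by (intro Min_in finite_independence_numbers) blast
  then show thesis
    using that by auto
qed

lemma ramsey_number_le_of_le_inverse_ramsey:
  assumes "t \<le> inverse_ramsey l n"
  shows "ramsey_number l t \<le> n"
proof (rule ramsey_number_leI)
  fix E assume E: "E \<subseteq> [{..<n}]\<^bsup>2\<^esup>"
  show "\<exists>K \<subseteq> {..<n}. card K = l \<and> clique K E \<or> card K = t \<and> indep K E"
  proof (cases "clique_free l n E")
    case True
    obtain I where I: "I \<subseteq> {..<n}" "indep I E" "card I = independence_number n E"
      by (rule independence_number_witness)
    then have "t \<le> card I"
      using inverse_ramsey_le[OF E True] assms by simp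
    then obtain J where "J \<subseteq> I" "card J = t"
      by (meson obtain_subset_with_card_n)
    then show ?thesis
      using I smaller_indep by (metis order_trans)
  next
    case False
    then show ?thesis
      unfolding clique_free_def by blast
  qed
qed

section \<open>Dense purple graphs\<close>

lemma finite_purple_cards:
  "finite {card P | R B P. rbp_colouring n R B P \<and>
     clique_free s n (R \<union> P) \<and> clique_free t n (B \<union> P)}"
  by (rule finite_surj[of "Pow ([{..<n}]\<^bsup>2\<^esup>)" _ card])
     (auto simp: finite_imp_finite_nsets rbp_colouring_def)

lemma card_le_max_purple:
  assumes "rbp_colouring n R B P" "clique_free s n (R \<union> P)" "clique_free t n (B \<union> P)"
  shows "card P \<le> max_purple n s t"
  unfolding max_purple_def using finite_purple_cards by (rule Max_ge) (use assms in blast)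

lemma max_purple_witness:
  assumes "rbp_colouring n R0 B0 P0" "clique_free s n (R0 \<union> P0)" "clique_free t n (B0 \<union> P0)"
  obtains R B P where "rbp_colouring n R B P" "clique_free s n (R \<union> P)" "clique_free t n (B \<union> P)"
    "card P = max_purple n s t"
proof -
  have "max_purple n s t \<in> {card P | R B P. rbp_colouring n R B P \<and>
     clique_free s n (R \<union> P) \<and> clique_free t n (B \<union> P)}"
    unfolding max_purple_def using finite_purple_cards
    by (rule Max_in) (use assms in blast)
  then show thesis
    using that by auto
qed

lemma card_purple_le:
  assumes "rbp_colouring n R B P"
  shows "card P \<le> n ^ 2"
proof -
  have "card P \<le> card ([{..<n}]\<^bsup>2\<^esup>)"
    using assms by (intro card_mono) (auto simp: rbp_colouring_def finite_imp_finite_nsets)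
  also have "\<dots> \<le> n ^ 2"
    using binomial_le_pow[of 2 n] by (cases "2 \<le> n") (auto simp: binomial_eq_0)
  finally show ?thesis .
qed

lemma bipartite_purple_colouring:
  assumes E: "E \<subseteq> [{..<n}]\<^bsup>2\<^esup>" "clique_free l n E"
    and s: "2 * (l - 1) < s" and l: "1 \<le> l" and t: "2 * independence_number n E < t"
  obtains R B P where "rbp_colouring n R B P" "clique_free s n (R \<union> P)" "clique_free t n (B \<union> P)"
    "card P = (n div 2) * (n - n div 2)"
proof -
  define X Y where "X = {..<n div 2}" and "Y = {n div 2..<n}"
  define P where "P = (\<lambda>(x, y). {x, y}) ` (X \<times> Y)"
  define R where "R = E - P"
  define B where "B = [{..<n}]\<^bsup>2\<^esup> - P - E"
  have XY: "X \<inter> Y = {}" "X \<union> Y = {..<n}" "finite X" "finite Y"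
    by (auto simp: X_def Y_def)
  have P2: "P \<subseteq> [{..<n}]\<^bsup>2\<^esup>"
    unfolding P_def XY(2)[symmetric] using XY(1) by auto
  have inX: "{x, y} \<notin> P" if "x \<in> X" "y \<in> X" for x y
    using that XY by (auto simp: P_def doubleton_eq_iff)
  have inY: "{x, y} \<notin> P" if "x \<in> Y" "y \<in> Y" for x y
    using that XY by (auto simp: P_def doubleton_eq_iff)
  have split: "card K \<le> card (K \<inter> X) + card (K \<inter> Y)" if "K \<subseteq> {..<n}" for K
  proof -
    have "K = (K \<inter> X) \<union> (K \<inter> Y)"
      using that XY by blast
    then show ?thesis
      by (metis card_Un_le)
  qed
  have colouring: "rbp_colouring n R B P"
    unfolding rbp_colouring_def R_def B_def using E(1) P2 by blast
  have card_clique: "card K < l" if "K \<subseteq> {..<n}" "clique K E" for K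
  proof (rule ccontr)
    assume "\<not> card K < l"
    then obtain L where "L \<subseteq> K" "card L = l"
      by (meson not_less obtain_subset_with_card_n)
    then show False
      using that E(2) smaller_clique unfolding clique_free_def by (metis order_trans)
  qed
  have red: "clique_free s n (R \<union> P)"
    unfolding clique_free_def
  proof clarify
    fix K assume K: "K \<subseteq> {..<n}" "clique K (R \<union> P)" "s = card K"
    have "clique (K \<inter> X) E" "clique (K \<inter> Y) E"
      using K(2) inX inY unfolding clique_def R_def by blast+
    then have "card (K \<inter> X) < l" "card (K \<inter> Y) < l"
      using card_clique K(1) by (meson inf.coboundedI1)+
    then show False
      using split[OF K(1)] K(3) s by linarith
  qed
  have blue: "clique_free t n (B \<union> P)"
    unfolding clique_free_def
  proof clarify
    fix K assume K: "K \<subseteq> {..<n}" "clique K (B \<union> P)" "t = card K"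
    have "indep (K \<inter> X) E" "indep (K \<inter> Y) E"
      using K(2) inX inY unfolding clique_def indep_def B_def by blast+
    then have "card (K \<inter> X) \<le> independence_number n E" "card (K \<inter> Y) \<le> independence_number n E"
      using card_le_independence_number K(1) by (meson inf.coboundedI1)+
    then show False
      using split[OF K(1)] K(3) t by linarith
  qed
  have "inj_on (\<lambda>(x, y). {x, y}) (X \<times> Y)"
    using XY(1) by (auto simp: inj_on_def doubleton_eq_iff)
  then have "card P = card (X \<times> Y)"
    unfolding P_def by (rule card_image)
  then have "card P = (n div 2) * (n - n div 2)"
    by (simp add: card_cartesian_product X_def Y_def)
  with colouring red blue show thesis
    by (rule that)
qed

lemma max_purple_bigtheta:
  assumes s: "3 \<le> s"
    and t: "\<forall>\<^sub>F n in sequentially.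
      t n \<ge> real (inverse_ramsey_real ((real s + 1) / 2) n) * log 2 (real n)"
  shows "(\<lambda>n. real (max_purple_real n (real s) (t n))) \<in> \<Theta>[sequentially](\<lambda>n. real n ^ 2)"
proof -
  define l where "l = (s + 1) div 2"
  have "\<lfloor>(real s + 1) / 2\<rfloor> = int l"
    using floor_divide_of_nat_eq[of "s + 1" 2, where 'a = real] by (simp add: l_def add.commute)
  then have inv: "inverse_ramsey_real ((real s + 1) / 2) n = inverse_ramsey l n" for n
    by (simp add: inverse_ramsey_real_def)
  have l: "2 \<le> l" "2 * (l - 1) < s"
    using s by (auto simp: l_def)
  have bounds: "\<forall>\<^sub>F n in sequentially. real n ^ 2 / 8 \<le> real (max_purple_real n (real s) (t n)) \<and>
    real (max_purple_real n (real s) (t n)) \<le> real n ^ 2"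
    using t eventually_gt_at_top[of 4]
  proof eventually_elim
    case (elim n)
    define T where "T = nat \<lceil>t n\<rceil>"
    obtain E where E: "E \<subseteq> [{..<n}]\<^bsup>2\<^esup>" "clique_free l n E"
      "independence_number n E = inverse_ramsey l n"
      using inverse_ramsey_witness l(1) by blast
    have "indep {0} E"
      by (simp add: indep_def)
    then have pos: "1 \<le> inverse_ramsey l n"
      using card_le_independence_number[of "{0}" n E] E(3) elim(2) by simp
    have "2 = log 2 (4 :: real)"
      using log_pow_cancel[of 2 2] by simp
    also have "\<dots> < log 2 (real n)"
      using elim(2) by (intro log_less) auto
    finally have "real (2 * inverse_ramsey l n) < real (inverse_ramsey l n) * log 2 (real n)"
      using pos by simp
    also have "\<dots> \<le> t n"
      using elim(1) by (simp add: inv)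
    also have "\<dots> \<le> real T"
      unfolding T_def by (rule real_nat_ceiling_ge)
    finally have "2 * independence_number n E < T"
      unfolding E(3) by linarith
    then obtain R B P where col: "rbp_colouring n R B P" "clique_free s n (R \<union> P)"
      "clique_free T n (B \<union> P)" and P: "card P = (n div 2) * (n - n div 2)"
      using bipartite_purple_colouring[OF E(1,2) l(2)] l(1) by (metis le_trans one_le_numeral)
    have eq: "max_purple_real n (real s) (t n) = max_purple n s T"
      by (simp add: max_purple_real_def T_def)
    have "real n / 4 \<le> real (n div 2)" "real n / 2 \<le> real (n - n div 2)"
      using elim(2) by linarith+
    then have "real n / 4 * (real n / 2) \<le> real (n div 2) * real (n - n div 2)"
      by (intro mult_mono) auto
    also have "\<dots> \<le> real (max_purple n s T)"
      using card_le_max_purple[OF col] P by (metis of_nat_le_iff of_nat_mult)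
    finally have lower: "real n ^ 2 / 8 \<le> real (max_purple n s T)"
      by (simp add: power2_eq_square)
    obtain R' B' P' where "rbp_colouring n R' B' P'" "card P' = max_purple n s T"
      using max_purple_witness[OF col] by metis
    then have "max_purple n s T \<le> n ^ 2"
      using card_purple_le by metis
    then have "real (max_purple n s T) \<le> real n ^ 2"
      by (metis of_nat_le_iff of_nat_power)
    with lower show ?case
      by (simp add: eq)
  qed
  show ?thesis
  proof (rule bigthetaI')
    show "\<forall>\<^sub>F n in sequentially.
      1 / 8 * norm (real n ^ 2) \<le> norm (real (max_purple_real n (real s) (t n))) \<and>
      norm (real (max_purple_real n (real s) (t n))) \<le> 1 * norm (real n ^ 2)"
      using bounds by eventually_elim simp
  qed auto
qed

section \<open>Dependent random choice\<close>

definition common_nbrs :: "'a set \<Rightarrow> 'a set set \<Rightarrow> 'a set \<Rightarrow> 'a set" where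
  "common_nbrs V P A = {v \<in> V. \<forall>u \<in> A. {u, v} \<in> P}"

lemma common_nbrs_subset: "common_nbrs V P A \<subseteq> V"
  by (auto simp: common_nbrs_def)

lemma subset_common_nbrs_commute:
  assumes "A \<subseteq> V" "B \<subseteq> V"
  shows "A \<subseteq> common_nbrs V P B \<longleftrightarrow> B \<subseteq> common_nbrs V P A"
proof -
  have "\<forall>u \<in> A. \<forall>v \<in> B. {u, v} = {v, u}"
    by blast
  then show ?thesis
    using assms unfolding common_nbrs_def subset_iff by auto
qed

lemma sum_card_swap:
  assumes "finite A" "finite B"
  shows "(\<Sum>x\<in>A. card {y \<in> B. Q x y}) = (\<Sum>y\<in>B. card {x \<in> A. Q x y})"
  using sum.swap_restrict[OF assms, of "\<lambda>_ _. 1 :: nat" Q] by simp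

lemma card_edges_le_sum_degrees:
  assumes "finite V" "P \<subseteq> [V]\<^bsup>2\<^esup>"
  shows "card P \<le> (\<Sum>v\<in>V. card (common_nbrs V P {v}))"
proof -
  have "P \<subseteq> (\<Union>v\<in>V. (\<lambda>u. {v, u}) ` common_nbrs V P {v})"
    using assms(2) by (fastforce simp: common_nbrs_def elim!: nsets2_E dest: subsetD)
  then have "card P \<le> card (\<Union>v\<in>V. (\<lambda>u. {v, u}) ` common_nbrs V P {v})"
    using assms(1) by (intro card_mono) (auto simp: common_nbrs_def)
  also have "\<dots> \<le> (\<Sum>v\<in>V. card ((\<lambda>u. {v, u}) ` common_nbrs V P {v}))"
    using assms(1) by (rule card_UN_le)
  also have "\<dots> \<le> (\<Sum>v\<in>V. card (common_nbrs V P {v}))"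
    using assms(1) by (intro sum_mono card_image_le) (auto simp: common_nbrs_def)
  finally show ?thesis .
qed

lemma sum_degree_power_ge:
  fixes \<eta> :: real
  assumes V: "finite V" "P \<subseteq> [V]\<^bsup>2\<^esup>" and \<eta>: "0 \<le> \<eta>" and P: "2 * \<eta> * real (card V) ^ 2 \<le> real (card P)"
  shows "(\<eta> * real (card V)) ^ Suc k \<le> (\<Sum>v\<in>V. real (card (common_nbrs V P {v})) ^ k)"
proof (cases "card V = 0")
  case True
  then show ?thesis
    by (simp add: sum_nonneg)
next
  case False
  define n where "n = real (card V)"
  define d where "d v = real (card (common_nbrs V P {v}))" for v
  have n: "n > 0"
    using False by (simp add: n_def)
  have d: "0 \<le> d v" "d v \<le> n" for v
    using V(1) by (auto simp: d_def n_def common_nbrs_def intro: card_mono)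
  have pointwise: "(\<eta> * n) ^ k * (d v - \<eta> * n) \<le> n * d v ^ k" for v
  proof (cases "d v \<le> \<eta> * n")
    case True
    then have "(\<eta> * n) ^ k * (d v - \<eta> * n) \<le> 0"
      using \<eta> n by (intro mult_nonneg_nonpos) auto
    also have "\<dots> \<le> n * d v ^ k"
      using n d by simp
    finally show ?thesis .
  next
    case False
    then have "(\<eta> * n) ^ k * (d v - \<eta> * n) \<le> d v ^ k * n"
      using \<eta> n d[of v] by (intro mult_mono power_mono) (auto intro: order_trans[of _ "d v"])
    then show ?thesis
      by (simp add: mult.commute)
  qed
  have "real (card P) \<le> (\<Sum>v\<in>V. d v)"
    using card_edges_le_sum_degrees[OF V] unfolding d_def by (metis of_nat_le_iff of_nat_sum)
  then have "\<eta> * n ^ 2 \<le> (\<Sum>v\<in>V. d v) - \<eta> * n ^ 2"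
    using P by (simp add: n_def)
  then have "(\<eta> * n) ^ k * (\<eta> * n ^ 2) \<le> (\<eta> * n) ^ k * ((\<Sum>v\<in>V. d v) - \<eta> * n ^ 2)"
    using \<eta> n by (intro mult_left_mono) auto
  also have "\<dots> = (\<Sum>v\<in>V. (\<eta> * n) ^ k * (d v - \<eta> * n))"
    by (simp add: sum_distrib_left[symmetric] sum_subtractf n_def power2_eq_square mult.left_commute)
  also have "\<dots> \<le> n * (\<Sum>v\<in>V. d v ^ k)"
    unfolding sum_distrib_left by (rule sum_mono) (rule pointwise)
  finally have "n * (\<eta> * n) ^ Suc k \<le> n * (\<Sum>v\<in>V. d v ^ k)"
    by (simp add: power2_eq_square algebra_simps)
  then show ?thesis
    using n by (simp add: d_def n_def)
qed

text \<open>A random \<open>k\<close>-tuple of vertices has on average a large common neighbourhood, which then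
  contains a member of \<open>\<K>\<close>; but few tuples lie in the common neighbourhood of a member of \<open>\<K>\<close>.\<close>

lemma sum_degree_power_le:
  assumes V: "finite V" and \<K>: "\<K> \<subseteq> [V]\<^bsup>m\<^esup>"
    and dense: "\<And>W. W \<subseteq> V \<Longrightarrow> a \<le> card W \<Longrightarrow> \<exists>K \<in> \<K>. K \<subseteq> W"
    and small: "\<And>K. K \<in> \<K> \<Longrightarrow> card (common_nbrs V P K) \<le> a"
  shows "(\<Sum>v\<in>V. card (common_nbrs V P {v}) ^ k) \<le> card V ^ k * a + card V * (card V ^ m * a ^ k)"
proof -
  define L where "L = {xs. set xs \<subseteq> V \<and> length xs = k}"
  have finL: "finite L" and cardL: "card L = card V ^ k"
    unfolding L_def using V by (auto simp: finite_lists_length_eq card_lists_length_eq)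
  have fin\<K>: "finite \<K>"
    using \<K> V finite_imp_finite_nsets finite_subset by blast
  have fin_nbrs: "finite (common_nbrs V P A)" for A
    using V by (simp add: common_nbrs_def)
  have lists: "card {xs \<in> L. A \<subseteq> common_nbrs V P (set xs)} = card (common_nbrs V P A) ^ k"
    if "A \<subseteq> V" for A
  proof -
    have "{xs \<in> L. A \<subseteq> common_nbrs V P (set xs)} =
        {xs. set xs \<subseteq> common_nbrs V P A \<and> length xs = k}"
      using subset_common_nbrs_commute[OF that] common_nbrs_subset[of V P A]
      unfolding L_def by blast
    then show ?thesis
      using fin_nbrs by (simp add: card_lists_length_eq)
  qed
  have card\<K>: "card \<K> \<le> card V ^ m"
  proof -
    have "card \<K> \<le> card V choose m"
      using card_mono[OF finite_imp_finite_nsets[OF V] \<K>] by simp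
    also have "\<dots> \<le> card V ^ m"
      by (cases "m \<le> card V") (auto simp: binomial_le_pow binomial_eq_0)
    finally show ?thesis .
  qed
  have pointwise: "card (common_nbrs V P (set xs)) \<le> a + card V * card {K \<in> \<K>. K \<subseteq> common_nbrs V P (set xs)}"
    for xs
  proof (cases "a \<le> card (common_nbrs V P (set xs))")
    case True
    then obtain K where "K \<in> \<K>" "K \<subseteq> common_nbrs V P (set xs)"
      using dense[of "common_nbrs V P (set xs)"] by (auto simp: common_nbrs_def)
    then have "1 \<le> card {K \<in> \<K>. K \<subseteq> common_nbrs V P (set xs)}"
      using fin\<K> by (auto simp: Suc_le_eq card_gt_0_iff)
    moreover have "card (common_nbrs V P (set xs)) \<le> card V"
      using V by (auto simp: common_nbrs_def intro: card_mono)
    ultimately show ?thesis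
      by (metis mult.right_neutral mult_le_mono2 order_trans trans_le_add2)
  qed simp
  have "(\<Sum>v\<in>V. card (common_nbrs V P {v}) ^ k) =
      (\<Sum>v\<in>V. card {xs \<in> L. {v} \<subseteq> common_nbrs V P (set xs)})"
    by (intro sum.cong refl lists[symmetric]) simp
  also have "\<dots> = (\<Sum>xs\<in>L. card {v \<in> V. {v} \<subseteq> common_nbrs V P (set xs)})"
    by (rule sum_card_swap[OF V finL])
  also have "\<dots> = (\<Sum>xs\<in>L. card (common_nbrs V P (set xs)))"
    by (rule sum.cong) (auto simp: common_nbrs_def)
  also have "\<dots> \<le> (\<Sum>xs\<in>L. a + card V * card {K \<in> \<K>. K \<subseteq> common_nbrs V P (set xs)})"
    by (rule sum_mono) (rule pointwise)
  also have "\<dots> = card V ^ k * a + card V * (\<Sum>xs\<in>L. card {K \<in> \<K>. K \<subseteq> common_nbrs V P (set xs)})"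
    by (simp add: sum.distrib cardL sum_distrib_left)
  also have "(\<Sum>xs\<in>L. card {K \<in> \<K>. K \<subseteq> common_nbrs V P (set xs)}) =
      (\<Sum>K\<in>\<K>. card {xs \<in> L. K \<subseteq> common_nbrs V P (set xs)})"
    by (rule sum_card_swap[OF finL fin\<K>])
  also have "\<dots> = (\<Sum>K\<in>\<K>. card (common_nbrs V P K) ^ k)"
    using \<K> by (intro sum.cong refl lists) (auto simp: nsets_def)
  also have "\<dots> \<le> card \<K> * a ^ k"
    using sum_bounded_above[of \<K> "\<lambda>K. card (common_nbrs V P K) ^ k" "a ^ k"] small
    by (simp add: power_mono)
  also have "\<dots> \<le> card V ^ m * a ^ k"
    using card\<K> by simp
  finally show ?thesis
    by simp
qed

lemma purple_density_bound:
  fixes \<eta> :: real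
  assumes col: "rbp_colouring n R B P"
    and red: "clique_free s n (R \<union> P)" and blue: "clique_free t n (B \<union> P)"
    and s: "s \<le> 2 * m" and \<eta>: "0 \<le> \<eta>" and P: "2 * \<eta> * real n ^ 2 \<le> real (card P)"
  shows "(\<eta> * real n) ^ Suc k \<le> real n ^ k * real (ramsey_number m t) +
    real n * (real n ^ m * real (ramsey_number m t) ^ k)"
proof -
  define a where "a = ramsey_number m t"
  define \<K> where "\<K> = {K \<in> [{..<n}]\<^bsup>m\<^esup>. clique K R}"
  have colour: "R \<union> B \<union> P = [{..<n}]\<^bsup>2\<^esup>" "P \<subseteq> [{..<n}]\<^bsup>2\<^esup>"
    using col by (auto simp: rbp_colouring_def)
  have dense: "\<exists>K \<in> \<K>. K \<subseteq> W" if W: "W \<subseteq> {..<n}" "a \<le> card W" for W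
  proof -
    have finW: "finite W"
      using W(1) finite_subset by blast
    obtain K where K: "K \<subseteq> W" "card K = m \<and> clique K R \<or> card K = t \<and> indep K R"
      using ramsey_number_clique_or_indep[OF finW] W(2) unfolding a_def by blast
    have "\<not> (card K = t \<and> indep K R)"
    proof
      assume *: "card K = t \<and> indep K R"
      have "clique K (B \<union> P)"
        unfolding clique_def
      proof (intro ballI impI)
        fix v w assume "v \<in> K" "w \<in> K" "v \<noteq> w"
        then have "{v, w} \<in> [{..<n}]\<^bsup>2\<^esup>" "{v, w} \<notin> R"
          using * K(1) W(1) by (auto simp: indep_def)
        then show "{v, w} \<in> B \<union> P"
          using colour(1) by blast
      qed
      then show False
        using * K(1) W(1) blue unfolding clique_free_def by blast
    qed
    then show ?thesis
      using K W(1) finW unfolding \<K>_def nsets_def by (blast intro: finite_subset)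
  qed
  have small: "card (common_nbrs {..<n} P K) \<le> a" if K: "K \<in> \<K>" for K
  proof (rule ccontr)
    assume "\<not> ?thesis"
    then obtain L where L: "L \<in> \<K>" "L \<subseteq> common_nbrs {..<n} P K"
      using dense[of "common_nbrs {..<n} P K"] by (auto simp: common_nbrs_def)
    have fin: "finite K" "finite L" "K \<subseteq> {..<n}" "L \<subseteq> {..<n}" "card K = m" "card L = m"
      and cliques: "clique K (R \<union> P)" "clique L (R \<union> P)"
      using K L(1) by (auto simp: \<K>_def nsets_def clique_def)
    have cross: "{v, w} \<in> P" if "v \<in> K" "w \<in> L" for v w
      using L(2) that by (auto simp: common_nbrs_def)
    have "K \<inter> L = {}"
    proof (rule ccontr)
      assume "K \<inter> L \<noteq> {}"
      then obtain v where "{v, v} \<in> P"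
        using cross by blast
      then show False
        using colour(2) doubleton_in_nsets_2[of v v "{..<n}"] by blast
    qed
    then have "card (K \<union> L) = 2 * m"
      using fin by (simp add: card_Un_disjoint)
    then obtain M where M: "M \<subseteq> K \<union> L" "card M = s"
      using s by (metis obtain_subset_with_card_n)
    have "clique (K \<union> L) (R \<union> P)"
      using cliques cross by (intro clique_Un) auto
    then have "clique M (R \<union> P)"
      using M(1) smaller_clique by blast
    then show False
      using red M fin(3,4) unfolding clique_free_def by blast
  qed
  have \<K>: "\<K> \<subseteq> [{..<n}]\<^bsup>m\<^esup>"
    by (auto simp: \<K>_def)
  have "(\<eta> * real n) ^ Suc k \<le> (\<Sum>v<n. real (card (common_nbrs {..<n} P {v})) ^ k)"
    using sum_degree_power_ge[of "{..<n}" P \<eta> k] colour(2) \<eta> P by simp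
  also have "\<dots> = real (\<Sum>v<n. card (common_nbrs {..<n} P {v}) ^ k)"
    by simp
  also have "\<dots> \<le> real (n ^ k * a + n * (n ^ m * a ^ k))"
    using sum_degree_power_le[OF finite_lessThan \<K> dense small, of k]
    by (simp del: of_nat_sum of_nat_add of_nat_mult of_nat_power)
  finally show ?thesis
    by (simp add: a_def)
qed

lemma max_purple_smallo:
  assumes s: "3 \<le> s" and gap: ramsey_gap_conjecture
    and t: "\<forall>\<^sub>F n in inf sequentially (principal (max_purple_dom s t)).
      t n \<le> real (inverse_ramsey_real ((real s + 3) / 2) n)"
  shows "(\<lambda>n. real (max_purple_real n (real s) (t n)))
    \<in> o[inf sequentially (principal (max_purple_dom s t))](\<lambda>n. real n ^ 2)"
proof (rule landau_o.smallI)
  fix c :: real assume c: "c > 0"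
  define m where "m = (s + 1) div 2"
  have m: "2 \<le> m" "s \<le> 2 * m"
    using s by (auto simp: m_def)
  have "\<lfloor>(real s + 3) / 2\<rfloor> = int (Suc m)"
    using floor_divide_of_nat_eq[of "s + 3" 2, where 'a = real] by (simp add: m_def add.commute)
  then have inv: "inverse_ramsey_real ((real s + 3) / 2) n = inverse_ramsey (Suc m) n" for n
    unfolding inverse_ramsey_real_def by (metis nat_int)
  have "3 \<le> Suc m"
    using m by simp
  then obtain \<theta> T0 where \<theta>: "\<theta> > 0" and T0: "\<And>T. T0 \<le> T \<Longrightarrow>
      real (ramsey_number m T) * real T powr \<theta> \<le> real (ramsey_number (Suc m) T)"
    using gap unfolding ramsey_gap_conjecture_def eventually_sequentially
    by (metis diff_Suc_1)
  define \<delta> where "\<delta> = \<theta> / real s"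
  define D where "D = (real s + 1) powr \<theta>"
  define \<eta> where "\<eta> = c / 2"
  define k where "k = nat \<lceil>(real m + 1) / \<delta>\<rceil>"
  have pos: "\<delta> > 0" "D > 0" "\<eta> > 0"
    using \<theta> s c by (auto simp: \<delta>_def D_def \<eta>_def)
  have "(real m + 1) / \<delta> \<le> real k"
    unfolding k_def by (rule real_nat_ceiling_ge)
  then have k: "real m + 1 \<le> \<delta> * real k"
    using pos by (simp add: field_simps)
  have lim1: "\<forall>\<^sub>F n in sequentially. D * real n powr (- \<delta>) < \<eta> ^ Suc k / 2"
  proof (rule order_tendstoD(2))
    show "(\<lambda>n. D * real n powr (- \<delta>)) \<longlonglongrightarrow> 0"
      using pos by (intro tendsto_mult_right_zero tendsto_neg_powr filterlim_real_sequentially) simp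
  qed (use pos in simp)
  have lim2: "\<forall>\<^sub>F n in sequentially. D ^ k * real n powr (- 1) < \<eta> ^ Suc k / 2"
  proof (rule order_tendstoD(2))
    show "(\<lambda>n. D ^ k * real n powr (- 1)) \<longlonglongrightarrow> 0"
      by (intro tendsto_mult_right_zero tendsto_neg_powr filterlim_real_sequentially) simp
  qed (use pos in simp)
  have "\<forall>\<^sub>F n in sequentially. n \<in> max_purple_dom s t \<longrightarrow>
      t n \<le> real (inverse_ramsey_real ((real s + 3) / 2) n)"
    using t by (simp add: eventually_inf_principal)
  then have "\<forall>\<^sub>F n in sequentially. n \<in> max_purple_dom s t \<longrightarrow>
      real (max_purple_real n (real s) (t n)) \<le> c * real n ^ 2"
    using lim1 lim2 eventually_ge_at_top[of "(s + T0) ^ s"] eventually_gt_at_top[of 0]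
  proof eventually_elim
    case (elim n)
    show ?case
    proof (intro impI, rule ccontr)
      assume dom: "n \<in> max_purple_dom s t"
      assume contra: "\<not> real (max_purple_real n (real s) (t n)) \<le> c * real n ^ 2"
      define T where "T = nat \<lceil>t n\<rceil>"
      define a where "a = real (ramsey_number m T)"
      have T2: "2 \<le> T" and nR: "n < ramsey_number s T"
        using dom nat_mono[of 2 "\<lceil>t n\<rceil>"]
        unfolding max_purple_dom_def T_def by simp_all
      have "t n \<le> real (inverse_ramsey (Suc m) n)"
        using elim(1) dom by (simp add: inv)
      then have "T \<le> inverse_ramsey (Suc m) n"
        unfolding T_def by linarith
      then have R1: "ramsey_number (Suc m) T \<le> n"
        by (rule ramsey_number_le_of_le_inverse_ramsey)
      have npow: "n < (s + T) ^ s"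
        using nR ramsey_number_le_power[of s T] by linarith
      have "T0 \<le> T"
      proof (rule ccontr)
        assume "\<not> T0 \<le> T"
        then have "(s + T) ^ s \<le> (s + T0) ^ s"
          by (intro power_mono) auto
        then show False
          using npow elim(4) by linarith
      qed
      then have gapT: "a * real T powr \<theta> \<le> real n"
        using T0[of T] R1 unfolding a_def by linarith
      have "s + T \<le> (s + 1) * T"
        using T2 by (simp add: mult_le_mono)
      then have "n \<le> ((s + 1) * T) ^ s"
        using npow power_mono[of "s + T" "(s + 1) * T" s] by linarith
      then have "real n \<le> ((real s + 1) * real T) ^ s"
        by (metis of_nat_1 of_nat_add of_nat_le_iff of_nat_mult of_nat_power)
      then have "real n powr \<delta> \<le> (((real s + 1) * real T) ^ s) powr \<delta>"
        using pos by (intro powr_mono2) auto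
      also have "\<dots> = ((real s + 1) * real T) powr \<theta>"
        using T2 s by (simp add: powr_realpow[symmetric] powr_powr \<delta>_def del: powr_realpow)
      also have "\<dots> = D * real T powr \<theta>"
        using T2 by (simp add: powr_mult D_def)
      finally have "a * real n powr \<delta> \<le> a * (D * real T powr \<theta>)"
        by (intro mult_left_mono) (auto simp: a_def)
      also have "\<dots> \<le> D * real n"
        using gapT pos by (simp add: mult.left_commute)
      finally have a_le: "a \<le> D * real n powr (- \<delta>) * real n"
        using elim(5) by (simp add: powr_minus field_simps)
      obtain E where E: "E \<subseteq> [{..<n}]\<^bsup>2\<^esup>" "clique_free s n E" "clique_free T n ([{..<n}]\<^bsup>2\<^esup> - E)"
        using nR by (rule lt_ramsey_numberE)
      have "rbp_colouring n E ([{..<n}]\<^bsup>2\<^esup> - E) {}"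
        using E(1) by (auto simp: rbp_colouring_def)
      then obtain R B P where col: "rbp_colouring n R B P" "clique_free s n (R \<union> P)"
        "clique_free T n (B \<union> P)" and P: "card P = max_purple n s T"
        using max_purple_witness[of n E "[{..<n}]\<^bsup>2\<^esup> - E" "{}" s T] E(2,3) by auto
      have "2 * \<eta> * real n ^ 2 \<le> real (card P)"
        using contra P by (simp add: \<eta>_def T_def max_purple_real_def)
      then have main: "(\<eta> * real n) ^ Suc k \<le> real n ^ k * a + real n * (real n ^ m * a ^ k)"
        unfolding a_def using purple_density_bound[OF col m(2)] pos by simp
      have first: "real n ^ k * a < real n ^ Suc k * (\<eta> ^ Suc k / 2)"
      proof -
        have "a < \<eta> ^ Suc k / 2 * real n"
          using a_le elim(2,5) by (meson mult_strict_right_mono of_nat_0_less_iff order_le_less_trans)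
        then have "real n ^ k * a < real n ^ k * (\<eta> ^ Suc k / 2 * real n)"
          using elim(5) by (intro mult_strict_left_mono) auto
        then show ?thesis
          by (simp add: mult_ac)
      qed
      have second: "real n * (real n ^ m * a ^ k) < real n ^ Suc k * (\<eta> ^ Suc k / 2)"
      proof -
        have "real n ^ m * (real n powr (- \<delta>)) ^ k = real n powr (real m - \<delta> * real k)"
          using elim(5)
          by (simp add: powr_realpow[symmetric] powr_powr powr_add[symmetric])
        also have "\<dots> \<le> real n powr (- 1)"
          using elim(5) k by (intro powr_mono) auto
        finally have exponent: "real n ^ m * (real n powr (- \<delta>)) ^ k \<le> real n powr (- 1)" .
        have "a ^ k \<le> (D * real n powr (- \<delta>) * real n) ^ k"
          using a_le by (intro power_mono) (auto simp: a_def)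
        then have "real n * (real n ^ m * a ^ k)
            \<le> real n * (real n ^ m * (D * real n powr (- \<delta>) * real n) ^ k)"
          by (intro mult_left_mono) auto
        also have "\<dots> = real n ^ Suc k * (D ^ k * (real n ^ m * (real n powr (- \<delta>)) ^ k))"
          by (simp add: power_mult_distrib mult_ac)
        also have "\<dots> \<le> real n ^ Suc k * (D ^ k * real n powr (- 1))"
          using exponent pos by (intro mult_left_mono) auto
        also have "\<dots> < real n ^ Suc k * (\<eta> ^ Suc k / 2)"
          using elim(3,5) by (intro mult_strict_left_mono) auto
        finally show ?thesis .
      qed
      have "(\<eta> * real n) ^ Suc k = real n ^ Suc k * (\<eta> ^ Suc k / 2) + real n ^ Suc k * (\<eta> ^ Suc k / 2)"
        by (simp add: power_mult_distrib mult_ac)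
      with main first second show False
        by linarith
    qed
  qed
  then show "\<forall>\<^sub>F n in inf sequentially (principal (max_purple_dom s t)).
      norm (real (max_purple_real n (real s) (t n))) \<le> c * norm (real n ^ 2)"
    by (simp add: eventually_inf_principal)
qed

theorem theorem1p8:
  fixes s :: nat
  assumes "s \<ge> 3"
    and "ramsey_gap_conjecture"
  shows "(\<forall>t :: nat \<Rightarrow> real.
            (\<forall>\<^sub>F n in sequentially.
               t n \<ge> real (inverse_ramsey_real ((real s + 1) / 2) n) * log 2 (real n)) \<longrightarrow>
            (\<lambda>n. real (max_purple_real n (real s) (t n))) \<in> \<Theta>[sequentially](\<lambda>n. real n ^ 2)) \<and>
         (\<forall>t :: nat \<Rightarrow> real.
            (\<forall>\<^sub>F n in inf sequentially (principal (max_purple_dom s t)).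
               t n \<le> real (inverse_ramsey_real ((real s + 3) / 2) n)) \<longrightarrow>
            (\<lambda>n. real (max_purple_real n (real s) (t n)))
               \<in> o[inf sequentially (principal (max_purple_dom s t))](\<lambda>n. real n ^ 2))"
  using assms max_purple_bigtheta max_purple_smallo by blast

end
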